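(* If the non-autonomous system $(X,f_{1,\infty})$ has the strong specification property (SSP), then $(\mathcal{K}(X),\overline{f}_{1,\infty})$ also has SSP.
   Context: A non-autonomous (discrete) system $(X,f_{1,\infty})$ consists of a compact metric space $(X,d)$ and a sequence $f_{1,\infty}=(f_n)_{n\ge 1}$ of continuous surjective maps $f_n:X\to X$. Write $\mathbb{N}=\{1,2,\dots\}$, $f_1^0=\mathrm{id}$ and $f_1^n=f_n\circ\cdots\circ f_1$ for $n\ge1$. $\mathcal{K}(X)$ is the space of non-empty compact subsets of $X$ with the Hausdorff metric $\mathcal{H}(A,B)=\inf\{\epsilon>0: A\subseteq N(B,\epsilon),\ B\subseteq N(A,\epsilon)\}$, where $N(A,\epsilon)=\bigcup_{a\in A}B_d(a,\epsilon)$ and $B_d(a,\epsilon)$ is the open ball. The induced system is $\overline{f}_{1,\infty}=(\overline{f}_n)_{n\ge1}$ with $\overline{f}_n(K)=f_n(K)$ for $K\in\mathcal{K}(X)$. A point $z$ is periodic with period $p\in\mathbb{N}$ if $f_1^{pm}(z)=z$ for every $m\in\mathbb{N}$ ($p$ need not be minimal). $(X,f_{1,\infty})$ has the strong specification property (SSP) if for every $\epsilon>0$ there is a positive integer $M(\epsilon)$ such that for every $s\in\mathbb{N}$, every choice of points $x_1,\dots,x_s\in X$, every sequence $a_1\le b_1<a_2\le b_2<\cdots<a_s\le b_s$ of non-negative integers with $a_j-b_{j-1}>M(\epsilon)$ for $2\le j\le s$, and every integer $p>M(\epsilon)+b_s-a_1$, there is a periodic point $z\in X$ with period $p$ such that $d(f_1^j(z),f_1^j(x_i))<\epsilon$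 for all $a_i\le j\le b_i$, $1\le i\le s$. For $(\mathcal{K}(X),\overline{f}_{1,\infty})$ the same definition is used with the metric $\mathcal{H}$. *)

theory Defs
  imports "HOL-Analysis.Analysis"
begin

text \<open>
  A sequence \<open>f\<^sub>1, f\<^sub>2, \<dots>\<close> of maps is represented by a function on \<open>nat\<close> whose value at \<open>0\<close>
  is never used; points and maps live in a carrier set, so that the same definitions apply
  to a space and to its hyperspace of compact subsets.
\<close>

locale nonautonomous_system = Metric_space X d
  for X :: "'a set" and d :: "'a \<Rightarrow> 'a \<Rightarrow> real" +
  fixes f :: "nat \<Rightarrow> 'a \<Rightarrow> 'a"
  assumes compact: "compact_space mtopology"
    and continuous: "\<And>n. 1 \<le> n \<Longrightarrow> continuous_map mtopology mtopology (f n)"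
    and surjective: "\<And>n. 1 \<le> n \<Longrightarrow> f n ` X = X"

primrec iterate :: "(nat \<Rightarrow> 'a \<Rightarrow> 'a) \<Rightarrow> nat \<Rightarrow> 'a \<Rightarrow> 'a" where
  "iterate f 0 = id"
| "iterate f (Suc n) = f (Suc n) \<circ> iterate f n"

text \<open>The period need not be minimal.\<close>

definition periodic_point :: "'a set \<Rightarrow> (nat \<Rightarrow> 'a \<Rightarrow> 'a) \<Rightarrow> nat \<Rightarrow> 'a \<Rightarrow> bool" where
  "periodic_point X f p z \<longleftrightarrow> z \<in> X \<and> 1 \<le> p \<and> (\<forall>m\<ge>1. iterate f (p * m) z = z)"

text \<open>
  The inequalities \<open>a\<^sub>j - b\<^sub>j\<^sub>-\<^sub>1 > M\<close> and \<open>p > M + b\<^sub>s - a\<^sub>1\<close> between integers are written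
  without subtraction, which truncates on \<open>nat\<close>.
\<close>

definition strong_specification ::
  "'a set \<Rightarrow> ('a \<Rightarrow> 'a \<Rightarrow> real) \<Rightarrow> (nat \<Rightarrow> 'a \<Rightarrow> 'a) \<Rightarrow> bool" where
  "strong_specification X d f \<longleftrightarrow>
    (\<forall>\<epsilon>>0. \<exists>M::nat. 1 \<le> M \<and>
      (\<forall>(s::nat) (x :: nat \<Rightarrow> 'a) (a :: nat \<Rightarrow> nat) (b :: nat \<Rightarrow> nat) (p::nat).
        1 \<le> s \<longrightarrow>
        (\<forall>i\<in>{1..s}. x i \<in> X) \<longrightarrow>
        (\<forall>i\<in>{1..s}. a i \<le> b i) \<longrightarrow>
        (\<forall>j\<in>{2..s}. b (j - 1) < a j) \<longrightarrow>
        (\<forall>j\<in>{2..s}. M + b (j - 1) < a j) \<longrightarrow>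
        M + b s < p + a 1 \<longrightarrow>
        (\<exists>z. periodic_point X f p z \<and>
          (\<forall>i\<in>{1..s}. \<forall>j\<in>{a i..b i}. d (iterate f j z) (iterate f j (x i)) < \<epsilon>))))"

context Metric_space
begin

definition compact_subsets :: "'a set set" where
  "compact_subsets = {K. K \<noteq> {} \<and> compactin mtopology K}"

definition nbhd :: "'a set \<Rightarrow> real \<Rightarrow> 'a set" where
  "nbhd A \<epsilon> = (\<Union>a\<in>A. mball a \<epsilon>)"

definition hausdorff :: "'a set \<Rightarrow> 'a set \<Rightarrow> real" where
  "hausdorff A B = Inf {\<epsilon>. 0 < \<epsilon> \<and> A \<subseteq> nbhd B \<epsilon> \<and> B \<subseteq> nbhd A \<epsilon>}"

end

definition induced :: "(nat \<Rightarrow> 'a \<Rightarrow> 'a) \<Rightarrow> nat \<Rightarrow> 'a set \<Rightarrow> 'a set" where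
  "induced f n K = f n ` K"

end

(* Approximate each of the compact sets K i by a finite subset F i that stays close to it along
   the orbits up to time b s.  Specification in X, applied to every choice function
   c in the product of the F i, yields periodic points z c; since there are finitely many of them,
   they form a compact set, and this set traces all the K i. *)

theory Submission
  imports Defs
begin

lemma iterate_induced: "iterate (induced f) n K = iterate f n ` K"
  by (induction n) (simp_all add: induced_def image_comp)

text \<open>The pointwise bounds place \<open>e\<close> itself in the set whose infimum is
  \<open>hausdorff A B\<close>, and that set is bounded below by 0. Passing to the infimum yields
  only a non-strict bound.\<close>

lemma (in Metric_space) hausdorff_le:
  assumes "A \<subseteq> M" "B \<subseteq> M" "0 < e"
    and AB: "\<And>x. x \<in> A \<Longrightarrow> \<exists>y\<in>B. d x y < e"
    and BA: "\<And>y. y \<in> B \<Longrightarrow> \<exists>x\<in>A. d x y < e"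
  shows "hausdorff A B \<le> e"
proof -
  have "A \<subseteq> nbhd B e"
    using assms(1,2) AB unfolding nbhd_def by (fastforce simp: commute)
  moreover have "B \<subseteq> nbhd A e"
    using assms(1,2) BA unfolding nbhd_def by fastforce
  ultimately show ?thesis
    unfolding hausdorff_def using \<open>0 < e\<close>
    by (intro cInf_lower bdd_belowI[of _ 0]) auto
qed

context nonautonomous_system
begin

lemma continuous_map_iterate: "continuous_map mtopology mtopology (iterate f n)"
proof (induction n)
  case (Suc n)
  then show ?case
    unfolding iterate.simps by (rule continuous_map_compose) (simp add: continuous)
qed simp

lemma iterate_in_space: "x \<in> X \<Longrightarrow> iterate f n x \<in> X"
  using continuous_map_iterate[of n] by (auto simp: continuous_map_def)

text \<open>The sets \<open>U y\<close> are Bowen balls, which control the orbit at all times up to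
  \<open>n\<close> at once. They are open because the iterates are continuous, so compactness of
  \<open>K\<close> leaves finitely many of them, with centres in \<open>K\<close>.\<close>

lemma finite_orbit_net:
  assumes K: "compactin mtopology K" and "0 < e"
  obtains F where "finite F" "F \<subseteq> K"
    "\<And>x. x \<in> K \<Longrightarrow> \<exists>y\<in>F. \<forall>j\<le>n. d (iterate f j y) (iterate f j x) < e"
proof -
  define U where "U y = (\<Inter>j\<in>{..n}. {x \<in> X. iterate f j x \<in> mball (iterate f j y) e})" for y
  have KX: "K \<subseteq> X"
    using K by (simp add: compactin_def)
  have open_U: "openin mtopology (U y)" for y
    unfolding U_def
    \<comment> \<open>The index set \<open>{..n}\<close> is finite and contains 0, so this is a
      nonempty finite intersection of open preimages.\<close>
    using openin_continuous_map_preimage[OF continuous_map_iterate openin_mball]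
    by (intro openin_Inter) auto
  have "K \<subseteq> \<Union> (U ` K)"
  proof
    fix x assume "x \<in> K"
    moreover have "x \<in> U x"
      using \<open>x \<in> K\<close> KX \<open>0 < e\<close> by (auto simp: U_def iterate_in_space subset_iff)
    ultimately show "x \<in> \<Union> (U ` K)"
      by blast
  qed
  then obtain \<F> where \<F>: "finite \<F>" "\<F> \<subseteq> U ` K" "K \<subseteq> \<Union>\<F>"
    using K open_U unfolding compactin_def by (metis (no_types, lifting) image_iff)
  then obtain F where F: "finite F" "F \<subseteq> K" "\<F> = U ` F"
    by (meson finite_subset_image)
  show thesis
  proof (rule that[OF F(1,2)])
    fix x assume "x \<in> K"
    then obtain y where "y \<in> F" "x \<in> U y"
      using \<F>(3) F(3) by auto
    then show "\<exists>y\<in>F. \<forall>j\<le>n. d (iterate f j y) (iterate f j x) < e"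
      by (auto simp: U_def)
  qed
qed

text \<open>The times and the period are fixed here; \<open>trace\<close> is the tracing property
  for them, with only the points varying. In the bound \<open>2 * e\<close>, one \<open>e\<close>
  pays for tracing and the other for replacing \<open>K i\<close> by a finite net.\<close>

lemma compact_specification:
  fixes K :: "nat \<Rightarrow> 'a set" and a b :: "nat \<Rightarrow> nat"
  assumes "0 < e" "1 \<le> s"
    and K: "\<And>i. i \<in> {1..s} \<Longrightarrow> K i \<in> compact_subsets"
    and trace: "\<And>x. (\<forall>i\<in>{1..s}. x i \<in> X) \<Longrightarrow>
      \<exists>z. periodic_point X f p z \<and>
        (\<forall>i\<in>{1..s}. \<forall>j\<in>{a i..b i}. d (iterate f j z) (iterate f j (x i)) < e)"
  shows "\<exists>Z. periodic_point compact_subsets (induced f) p Z \<and>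
    (\<forall>i\<in>{1..s}. \<forall>j\<in>{a i..b i}.
      hausdorff (iterate (induced f) j Z) (iterate (induced f) j (K i)) \<le> 2 * e)"
proof -
  have KX: "K i \<subseteq> X" and K_ne: "K i \<noteq> {}" if "i \<in> {1..s}" for i
    using K[OF that] by (auto simp: compact_subsets_def compactin_def)
  have "\<exists>F. finite F \<and> F \<subseteq> K i \<and>
      (\<forall>x\<in>K i. \<exists>y\<in>F. \<forall>j\<le>b i. d (iterate f j y) (iterate f j x) < e)" if "i \<in> {1..s}" for i
    using K[OF that] \<open>0 < e\<close> finite_orbit_net[of "K i" e "b i"]
    unfolding compact_subsets_def by (metis (mono_tags, lifting) mem_Collect_eq)
  then obtain F where fin: "\<And>i. i \<in> {1..s} \<Longrightarrow> finite (F i)"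
    and FK: "\<And>i. i \<in> {1..s} \<Longrightarrow> F i \<subseteq> K i"
    and net: "\<And>i x. i \<in> {1..s} \<Longrightarrow> x \<in> K i \<Longrightarrow>
      \<exists>y\<in>F i. \<forall>j\<le>b i. d (iterate f j y) (iterate f j x) < e"
    by metis
  have F_ne: "F i \<noteq> {}" if "i \<in> {1..s}" for i
    using net[OF that] K_ne[OF that] by blast
  \<comment> \<open>Functions in \<open>PiE\<close> are \<open>undefined\<close> outside
    \<open>{1..s}\<close>, so finite sets \<open>F i\<close> give only finitely many
    choices.\<close>
  define C where "C = PiE {1..s} F"
  have C_mem: "c i \<in> F i" if "c \<in> C" "i \<in> {1..s}" for c i
    using that unfolding C_def by (rule PiE_mem)
  have "finite C"
    unfolding C_def using fin by (intro finite_PiE) auto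
  obtain c0 where c0: "c0 \<in> C"
    using F_ne by (metis C_def PiE_eq_empty_iff ex_in_conv)
  have "\<exists>z. periodic_point X f p z \<and>
      (\<forall>i\<in>{1..s}. \<forall>j\<in>{a i..b i}. d (iterate f j z) (iterate f j (c i)) < e)" if "c \<in> C" for c
    using C_mem[OF that] FK KX by (intro trace) blast
  then obtain z where per: "\<And>c. c \<in> C \<Longrightarrow> periodic_point X f p (z c)"
    and close: "\<And>c i j. \<lbrakk>c \<in> C; i \<in> {1..s}; j \<in> {a i..b i}\<rbrakk> \<Longrightarrow>
      d (iterate f j (z c)) (iterate f j (c i)) < e"
    by metis
  define Z where "Z = z ` C"
  have ZX: "Z \<subseteq> X"
    using per by (auto simp: Z_def periodic_point_def)
  have "Z \<in> compact_subsets"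
    using ZX c0 \<open>finite C\<close> finite_imp_compactin[of Z mtopology]
    by (auto simp: compact_subsets_def Z_def)
  \<comment> \<open>All the points \<open>z c\<close> share the period \<open>p\<close>, so
    \<open>Z\<close> is fixed pointwise.\<close>
  moreover have "iterate f (p * m) ` Z = Z" if "1 \<le> m" for m
    using per that by (force simp: Z_def image_image periodic_point_def)
  moreover have "1 \<le> p"
    using per[OF c0] by (simp add: periodic_point_def)
  ultimately have "periodic_point compact_subsets (induced f) p Z"
    by (simp add: periodic_point_def iterate_induced)
  moreover have "hausdorff (iterate (induced f) j Z) (iterate (induced f) j (K i)) \<le> 2 * e"
    if i: "i \<in> {1..s}" and j: "j \<in> {a i..b i}" for i j
    unfolding iterate_induced
  proof (rule hausdorff_le)
    show "iterate f j ` Z \<subseteq> X" "iterate f j ` K i \<subseteq> X" "0 < 2 * e"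
      using ZX KX[OF i] \<open>0 < e\<close> by (auto intro: iterate_in_space)
  next
    fix w assume "w \<in> iterate f j ` Z"
    then obtain c where c: "c \<in> C" "w = iterate f j (z c)"
      by (auto simp: Z_def)
    \<comment> \<open>This direction costs a single \<open>e\<close>, since \<open>c i\<close>
      already lies in \<open>K i\<close>.\<close>
    then have "d w (iterate f j (c i)) < 2 * e"
      using close[OF c(1) i j] \<open>0 < e\<close> by simp
    then show "\<exists>y\<in>iterate f j ` K i. d w y < 2 * e"
      using C_mem[OF c(1) i] FK[OF i] by blast
  next
    fix y assume "y \<in> iterate f j ` K i"
    then obtain x where x: "x \<in> K i" "y = iterate f j x"
      by blast
    obtain v where v: "v \<in> F i" "d (iterate f j v) (iterate f j x) < e"
      using net[OF i x(1)] j by auto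
    \<comment> \<open>Changing \<open>c0\<close> at \<open>i\<close> alone shows that every net
      point \<open>v\<close> is the \<open>i\<close>-th value of some choice. This is why
      \<open>Z\<close> collects the tracing points of the full product: it must come close to all of
      \<open>K i\<close>.\<close>
    define c where "c = c0(i := v)"
    have c: "c \<in> C" "c i = v"
      using c0 v(1) i by (auto simp: c_def C_def PiE_iff extensional_def)
    have "z c \<in> X" "v \<in> X" "x \<in> X"
      using per[OF c(1)] v(1) FK[OF i] x(1) KX[OF i] by (auto simp: periodic_point_def)
    then have "d (iterate f j (z c)) y
        \<le> d (iterate f j (z c)) (iterate f j v) + d (iterate f j v) (iterate f j x)"
      unfolding x(2) by (intro triangle iterate_in_space)
    also have "\<dots> < 2 * e"
      using close[OF c(1) i j] v(2) c(2) by simp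
    finally show "\<exists>w\<in>iterate f j ` Z. d w y < 2 * e"
      using c(1) by (auto simp: Z_def)
  qed
  ultimately show ?thesis
    by blast
qed

end

theorem theorem5p1:
  fixes X :: "'a set" and d :: "'a \<Rightarrow> 'a \<Rightarrow> real" and f :: "nat \<Rightarrow> 'a \<Rightarrow> 'a"
  assumes "nonautonomous_system X d f"
    and "strong_specification X d f"
  shows "strong_specification (Metric_space.compact_subsets X d)
           (Metric_space.hausdorff X d) (induced f)"
  unfolding strong_specification_def
proof (intro allI impI, goal_cases)
  case (1 \<epsilon>)
  interpret nonautonomous_system X d f
    by (rule assms(1))
  \<comment> \<open>With \<open>\<epsilon> / 4\<close> the Hausdorff bound becomes
    \<open>\<epsilon> / 2\<close>, which restores the strict inequality. The gap constant for
    \<open>\<epsilon>\<close> in the hyperspace is thus the one for \<open>\<epsilon> / 4\<close> in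
    \<open>X\<close>.\<close>
  have e: "0 < \<epsilon> / 4"
    using 1 by simp
  obtain N where "1 \<le> N"
    and N: "\<And>(s::nat) x (a::nat \<Rightarrow> nat) b p. \<lbrakk>1 \<le> s; \<forall>i\<in>{1..s}. x i \<in> X; \<forall>i\<in>{1..s}. a i \<le> b i;
        \<forall>j\<in>{2..s}. b (j - 1) < a j; \<forall>j\<in>{2..s}. N + b (j - 1) < a j; N + b s < p + a 1\<rbrakk> \<Longrightarrow>
      \<exists>z. periodic_point X f p z \<and>
        (\<forall>i\<in>{1..s}. \<forall>j\<in>{a i..b i}. d (iterate f j z) (iterate f j (x i)) < \<epsilon> / 4)"
    using assms(2)[unfolded strong_specification_def, rule_format (no_asm), OF e] by blast
  show ?case
  proof (intro exI[of _ N] conjI allI impI, goal_cases)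
    case 1
    show ?case by (rule \<open>1 \<le> N\<close>)
  next
    case (2 s K a b p)
    have "\<exists>Z. periodic_point compact_subsets (induced f) p Z \<and>
      (\<forall>i\<in>{1..s}. \<forall>j\<in>{a i..b i}.
        hausdorff (iterate (induced f) j Z) (iterate (induced f) j (K i)) \<le> 2 * (\<epsilon> / 4))"
      by (rule compact_specification[OF e 2(1) _ N[OF 2(1) _ 2(3-6)]]) (use 2(2) in auto)
    then show ?case
      using e by fastforce
  qed
qed

end
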